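(* Let $G=\mathrm{Sz}(q)$ be the Suzuki group with $q=2^{2n+1}$, $n\geq 1$, and let $\mathcal{C}$ be its conjugacy class of involutions. Then $\mathcal{K}(G,\mathcal{C})$ equals the commuting graph on $\mathcal{C}$, and $K_{\mathcal{C}}$ is reducible and non-degenerate.
   Context: For a finite group $G$ and a subset $\mathcal{C}\subseteq G\setminus\{1\}$ closed under conjugation, the Killing form $K_{\mathcal{C}}$ is the bilinear form on the complex vector space with basis $\mathcal{C}$ given on basis elements by $K_{\mathcal{C}}(a,b)=|C_G(ab)\cap\mathcal{C}|$; it is non-degenerate if the matrix $(K_{\mathcal{C}}(a,b))_{a,b\in\mathcal{C}}$ is invertible. $\mathcal{K}(G,\mathcal{C})$ is the graph with vertex set $\mathcal{C}$ in which distinct $a,b$ are adjacent iff $C_G(ab)\cap\mathcal{C}\neq\emptyset$. $K_{\mathcal{C}}$ is irreducible if $\mathcal{K}(G,\mathcal{C})$ is connected and reducible otherwise. The commuting graph on $\mathcal{C}$ has vertex set $\mathcal{C}$, with distinct $a,b$ adjacent iff $ab=ba$. *)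

theory Defs
  imports "HOL-Analysis.Cartesian_Space" "HOL-Library.Numeral_Type"
begin

definition killing_form :: "('g \<Rightarrow> 'g \<Rightarrow> 'g) \<Rightarrow> 'g set \<Rightarrow> 'g set \<Rightarrow> 'g \<Rightarrow> 'g \<Rightarrow> nat" where
  "killing_form mul G C a b =
     card ({x \<in> G. mul x (mul a b) = mul (mul a b) x} \<inter> C)"

definition killing_nondegenerate :: "('g \<Rightarrow> 'g \<Rightarrow> 'g) \<Rightarrow> 'g set \<Rightarrow> 'g set \<Rightarrow> bool" where
  "killing_nondegenerate mul G C \<longleftrightarrow>
     (\<exists>N :: 'g \<Rightarrow> 'g \<Rightarrow> complex.
        (\<forall>a\<in>C. \<forall>b\<in>C. (\<Sum>c\<in>C. of_nat (killing_form mul G C a c) * N c b) = (if a = b then 1 else 0)) \<and>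
        (\<forall>a\<in>C. \<forall>b\<in>C. (\<Sum>c\<in>C. N a c * of_nat (killing_form mul G C c b)) = (if a = b then 1 else 0)))"

definition killing_adj :: "('g \<Rightarrow> 'g \<Rightarrow> 'g) \<Rightarrow> 'g set \<Rightarrow> 'g set \<Rightarrow> 'g \<Rightarrow> 'g \<Rightarrow> bool" where
  "killing_adj mul G C a b \<longleftrightarrow>
     a \<in> C \<and> b \<in> C \<and> a \<noteq> b \<and> {x \<in> G. mul x (mul a b) = mul (mul a b) x} \<inter> C \<noteq> {}"

definition commuting_adj :: "('g \<Rightarrow> 'g \<Rightarrow> 'g) \<Rightarrow> 'g set \<Rightarrow> 'g \<Rightarrow> 'g \<Rightarrow> bool" where
  "commuting_adj mul C a b \<longleftrightarrow> a \<in> C \<and> b \<in> C \<and> a \<noteq> b \<and> mul a b = mul b a"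

definition graph_connected :: "'g set \<Rightarrow> ('g \<Rightarrow> 'g \<Rightarrow> bool) \<Rightarrow> bool" where
  "graph_connected V E \<longleftrightarrow> (\<forall>a\<in>V. \<forall>b\<in>V. E\<^sup>*\<^sup>* a b)"

definition killing_irreducible :: "('g \<Rightarrow> 'g \<Rightarrow> 'g) \<Rightarrow> 'g set \<Rightarrow> 'g set \<Rightarrow> bool" where
  "killing_irreducible mul G C \<longleftrightarrow> graph_connected C (killing_adj mul G C)"

definition conj_class :: "('g \<Rightarrow> 'g \<Rightarrow> 'g) \<Rightarrow> 'g set \<Rightarrow> 'g \<Rightarrow> 'g set" where
  "conj_class mul G t = {y \<in> G. \<exists>x\<in>G. mul y x = mul x t}"

text \<open>theta: x \<mapsto> x^(2^(n+1)), so that theta(theta x) = x^2.\<close>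

definition sz_theta :: "nat \<Rightarrow> 'a::field \<Rightarrow> 'a" where
  "sz_theta n x = x ^ (2 ^ (n + 1))"

definition sz_T :: "nat \<Rightarrow> 'a::field \<Rightarrow> 'a \<Rightarrow> 'a ^ 4 ^ 4" where
  "sz_T n a b = vector [
     vector [1, 0, 0, 0],
     vector [a, 1, 0, 0],
     vector [b, sz_theta n a, 1, 0],
     vector [a ^ 2 * sz_theta n a + a * b + sz_theta n b, a * sz_theta n a + b, a, 1]]"

definition sz_M :: "nat \<Rightarrow> 'a::field \<Rightarrow> 'a ^ 4 ^ 4" where
  "sz_M n k = vector [
     vector [k ^ (1 + 2 ^ n), 0, 0, 0],
     vector [0, k ^ (2 ^ n), 0, 0],
     vector [0, 0, inverse (k ^ (2 ^ n)), 0],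
     vector [0, 0, 0, inverse (k ^ (1 + 2 ^ n))]]"

definition sz_W :: "'a::field ^ 4 ^ 4" where
  "sz_W = vector [
     vector [0, 0, 0, 1],
     vector [0, 0, 1, 0],
     vector [0, 1, 0, 0],
     vector [1, 0, 0, 0]]"

text \<open>Sz(q) is the subgroup of GL_4(F_q) generated by all sz_T n a b, all sz_M n k
  (k \<noteq> 0) and sz_W; being finite, it is the closure of the identity under
  right multiplication by generators.\<close>

inductive_set suzuki_group :: "nat \<Rightarrow> ('a::field ^ 4 ^ 4) set" for n :: nat where
  one: "mat 1 \<in> suzuki_group n"
| T: "g \<in> suzuki_group n \<Longrightarrow> g ** sz_T n a b \<in> suzuki_group n"
| M: "g \<in> suzuki_group n \<Longrightarrow> k \<noteq> 0 \<Longrightarrow> g ** sz_M n k \<in> suzuki_group n"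
| W: "g \<in> suzuki_group n \<Longrightarrow> g ** sz_W \<in> suzuki_group n"

end

(* Sz(q) has a Bruhat decomposition G = B + BWS, where S is the group of the T a b, B = SD, and D
   is the diagonal torus.  It shows that every involution is conjugate to T 0 1, that the
   centralizer of T 0 1 is contained in S, and that an element of G conjugating a nontrivial element
   of S into S lies in B.  If an involution x centralizes y = ab, move x to T 0 1: then y lies in S
   and is inverted by a, so a and b are involutions of B, hence of the form T 0 u, and commute.
   Thus commuting is an equivalence relation on the involutions, with classes of equal size r, and
   the matrix of the Killing form is block diagonal with blocks (|C| - r) I + r J, which are
   invertible.  T 0 1 and W do not commute, so there are at least two blocks. *)

theory Submission
  imports Defs
begin

section \<open>Entries of four-by-four matrices and two facts on finite rings\<close>

lemma vector_4 [simp]: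
  "(vector [x, y, z, w] :: 'a::zero ^ 4) $ 1 = x"
  "(vector [x, y, z, w] :: 'a::zero ^ 4) $ 2 = y"
  "(vector [x, y, z, w] :: 'a::zero ^ 4) $ 3 = z"
  "(vector [x, y, z, w] :: 'a::zero ^ 4) $ 4 = w"
  unfolding vector_def by simp_all

lemma matrix_4_eq_iff:
  fixes A B :: "'a ^ 4 ^ 4"
  shows "A = B \<longleftrightarrow> (\<forall>i\<in>{1,2,3,4}. \<forall>j\<in>{1,2,3,4}. A $ i $ j = B $ i $ j)"
  by (simp add: vec_eq_iff forall_4)

lemma matrix_4_mult_nth:
  fixes A B :: "'a::semiring_1 ^ 4 ^ 4"
  shows "(A ** B) $ i $ j = A$i$1 * B$1$j + A$i$2 * B$2$j + A$i$3 * B$3$j + A$i$4 * B$4$j"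
  by (simp add: matrix_matrix_mult_def sum_4)

text \<open>Multiplication by a nonzero \<open>x\<close> permutes the nonzero elements, so their
  product absorbs \<open>x ^ (CARD('a) - 1)\<close>; an extra factor \<open>x\<close> brings the
  exponent to \<open>CARD('a)\<close>.\<close>

lemma finite_field_pow_card:
  fixes x :: "'a::{field,finite}"
  shows "x ^ CARD('a) = x"
proof (cases "x = 0")
  case False
  have "x * (\<Prod>y\<in>UNIV-{0}. x * y) = x * x ^ (CARD('a) - 1) * \<Prod>(UNIV-{0})"
    by (simp add: prod.distrib mult_ac)
  also have "x * x ^ (CARD('a) - 1) = x ^ CARD('a)"
    by (metis power_minus_mult finite_UNIV_card_ge_0 finite mult.commute)
  also have "(\<Prod>y\<in>UNIV-{0}. x * y) = (\<Prod>y\<in>UNIV-{0}. y)"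
    by (rule prod.reindex_bij_witness[of _ "\<lambda>y. y / x" "\<lambda>y. x * y"]) (use False in auto)
  finally show ?thesis
    by simp
qed (use finite_UNIV_card_ge_0[where ?'a = 'a] in auto)

text \<open>The shift by 1 permutes the ring, so adding 1 to every element leaves the total sum
  unchanged.\<close>

lemma of_nat_card_eq_0: "of_nat CARD('a) = (0 :: 'a::{ring_1,finite})"
proof -
  have "(\<Sum>x\<in>UNIV. x + 1) = (\<Sum>x\<in>UNIV. x :: 'a)"
    by (rule sum.reindex_bij_witness[of _ "\<lambda>x. x - 1" "\<lambda>x. x + 1"]) auto
  then show ?thesis
    by (simp add: sum.distrib)
qed

section \<open>Block matrices of an equivalence relation\<close>

text \<open>Entrywise form of \<open>(p I + q E) (u I + v E)\<close>, where \<open>E\<close> is the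
  0/1 matrix of the relation. Classes of common size \<open>r\<close> give
  \<open>E E = r E\<close>.\<close>

lemma sum_block_mult:
  fixes p q u v :: complex
  assumes "finite C" and E: "\<forall>a\<in>C. \<forall>b\<in>C. E a b \<longrightarrow> E b a"
      "\<forall>a\<in>C. \<forall>b\<in>C. \<forall>c\<in>C. E a b \<longrightarrow> E b c \<longrightarrow> E a c"
    and card: "\<forall>a\<in>C. card {c \<in> C. E a c} = r" and ab: "a \<in> C" "b \<in> C"
  shows "(\<Sum>c\<in>C. (p * of_bool (a = c) + q * of_bool (E a c)) * (u * of_bool (c = b) + v * of_bool (E c b))) =
    p * u * of_bool (a = b) + (p * v + q * u + q * v * of_nat r) * of_bool (E a b)"
proof -
  have "(\<Sum>c\<in>C. (of_bool (E a c) * of_bool (E c b) :: complex)) = of_nat r * of_bool (E a b)"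
  proof (cases "E a b")
    case True
    have "E c b \<longleftrightarrow> E a c" if "c \<in> C" for c
      using E ab True that by blast
    then have "(\<Sum>c\<in>C. (of_bool (E a c) * of_bool (E c b) :: complex)) = (\<Sum>c\<in>C. of_bool (E a c))"
      by (intro sum.cong) simp_all
    also have "\<dots> = of_nat (card {c \<in> C. E a c})"
      by (simp add: of_bool_def sum.If_cases \<open>finite C\<close> Int_def)
    finally show ?thesis using card ab True by simp
  next
    case False
    have "\<not> (E a c \<and> E c b)" if "c \<in> C" for c
      using E(2) ab False that by blast
    then have "(\<Sum>c\<in>C. (of_bool (E a c) * of_bool (E c b) :: complex)) = (\<Sum>c\<in>C. 0)"
      by (intro sum.cong) simp_all
    then show ?thesis using False by simp
  qed
  moreover have "(p * of_bool (a = c) + q * of_bool (E a c)) * (u * of_bool (c = b) + v * of_bool (E c b)) =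
     (if c = a then p * (u * of_bool (a = b) + v * of_bool (E a b)) else 0) +
     (if c = b then q * u * of_bool (E a b) else 0) +
     q * v * (of_bool (E a c) * of_bool (E c b))" for c
    by (cases "c = a"; cases "c = b") (simp_all add: algebra_simps)
  ultimately show ?thesis
    using \<open>finite C\<close> ab by (simp add: sum.distrib algebra_simps flip: sum_distrib_left)
qed

lemma killing_nondegenerate_block:
  assumes fin: "finite C" and E: "\<forall>a\<in>C. E a a" "\<forall>a\<in>C. \<forall>b\<in>C. E a b \<longrightarrow> E b a"
      "\<forall>a\<in>C. \<forall>b\<in>C. \<forall>c\<in>C. E a b \<longrightarrow> E b c \<longrightarrow> E a c"
    and card: "\<forall>a\<in>C. card {c \<in> C. E a c} = r"
    and K: "\<forall>a\<in>C. \<forall>b\<in>C. killing_form mul G C a b = (if a = b then s else if E a b then r else 0)"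
    and "r < s"
  shows "killing_nondegenerate mul G C"
proof -
  \<comment> \<open>The matrix is \<open>d I + r E\<close> with \<open>E\<^sup>2 = r E\<close>, so its inverse is \<open>(1 / d) I + v E\<close>.\<close>
  define d :: complex where "d = of_nat (s - r)"
  define v where "v = - of_nat r / (d * (d + of_nat (r\<^sup>2)))"
  have d: "d \<noteq> 0" using \<open>r < s\<close> by (simp add: d_def)
  \<comment> \<open>Written as the image of a positive natural number, the sum cannot vanish in the
    complex numbers.\<close>
  have "d + of_nat (r\<^sup>2) = of_nat (s - r + r\<^sup>2)" by (simp add: d_def)
  also have "\<dots> \<noteq> 0" using \<open>r < s\<close> unfolding of_nat_eq_0_iff by simp
  finally have d': "d + of_nat (r\<^sup>2) \<noteq> 0" .
  \<comment> \<open>This is the coefficient of \<open>E\<close> in the product with the candidate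
    inverse; \<open>v\<close> was obtained by solving for its vanishing.\<close>
  have eq: "d * v + of_nat r * (1 / d) + of_nat r * v * of_nat r = 0"
  proof -
    have "d * v + of_nat r * (1 / d) + of_nat r * v * of_nat r = (d + of_nat (r\<^sup>2)) * v + of_nat r / d"
      by (simp add: algebra_simps power2_eq_square)
    also have "\<dots> = 0" using d d' by (simp add: v_def)
    finally show ?thesis .
  qed
  have K': "of_nat (killing_form mul G C a b) = d * of_bool (a = b) + of_nat r * of_bool (E a b)"
    if "a \<in> C" "b \<in> C" for a b
    using that K E(1) \<open>r < s\<close> by (auto simp: d_def)
  define N where "N a b = 1 / d * of_bool (a = b) + v * of_bool (E a b)" for a b
  note block = sum_block_mult[OF fin E(2,3) card]
  have "(\<Sum>c\<in>C. of_nat (killing_form mul G C a c) * N c b) = (if a = b then 1 else 0)"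
    if "a \<in> C" "b \<in> C" for a b
  proof -
    have "(\<Sum>c\<in>C. of_nat (killing_form mul G C a c) * N c b) =
        (\<Sum>c\<in>C. (d * of_bool (a = c) + of_nat r * of_bool (E a c)) * N c b)"
      using that by (intro sum.cong) (simp_all add: K')
    then show ?thesis unfolding N_def block[OF that] eq using d by simp
  qed
  moreover have "(\<Sum>c\<in>C. N a c * of_nat (killing_form mul G C c b)) = (if a = b then 1 else 0)"
    if "a \<in> C" "b \<in> C" for a b
  proof -
    have "(\<Sum>c\<in>C. N a c * of_nat (killing_form mul G C c b)) =
        (\<Sum>c\<in>C. N a c * (d * of_bool (c = b) + of_nat r * of_bool (E c b)))"
      using that by (intro sum.cong) (simp_all add: K')
    moreover have "1 / d * of_nat r + v * d + v * of_nat r * of_nat r = 0"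
      using eq by (simp add: mult_ac add_ac)
    ultimately show ?thesis unfolding N_def block[OF that] using d by simp
  qed
  ultimately show ?thesis unfolding killing_nondegenerate_def by blast
qed

section \<open>Characteristic two and the field automorphism \<open>theta\<close>\<close>

locale suzuki =
  fixes n :: nat and field_type :: "'a::{field,finite} itself"
  assumes card_field: "CARD('a) = 2 ^ (2 * n + 1)"
begin

abbreviation theta :: "'a \<Rightarrow> 'a" where "theta \<equiv> sz_theta n"
abbreviation T :: "'a \<Rightarrow> 'a \<Rightarrow> 'a ^ 4 ^ 4" where "T \<equiv> sz_T n"
abbreviation W :: "'a ^ 4 ^ 4" where "W \<equiv> sz_W"
abbreviation G :: "('a ^ 4 ^ 4) set" where "G \<equiv> suzuki_group n"
abbreviation I :: "'a ^ 4 ^ 4" where "I \<equiv> mat 1"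

lemma two_eq_0: "(2 :: 'a) = 0"
  using of_nat_card_eq_0[where 'a = 'a] by (simp add: card_field del: power_Suc power_add)

lemma add_self [simp]: "x + x = (0 :: 'a)"
  by (metis mult_2 mult_zero_left two_eq_0)

lemma add_self_left [simp]: "x + (x + y) = (y :: 'a)"
  by (simp flip: add.assoc)

lemma uminus_eq [simp]: "- x = (x :: 'a)"
  by (rule minus_unique) simp

lemma add_eq_0_iff_eq [simp]: "x + y = 0 \<longleftrightarrow> x = (y :: 'a)"
  by (metis add_self_left add_0_right add_self)

text \<open>Iterated Frobenius: squaring is additive because the cross term carries a factor
  2.\<close>

lemma power_two_power_add: "(x + y) ^ (2 ^ m) = x ^ (2 ^ m) + (y :: 'a) ^ (2 ^ m)"
proof (induction m)
  case (Suc m)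
  then show ?case
    by (simp add: power_mult mult.commute[of 2] power2_sum two_eq_0)
qed simp

lemma theta_add: "theta (x + y) = theta x + theta y"
  unfolding sz_theta_def by (rule power_two_power_add)

lemma theta_mult: "theta (x * y) = theta x * theta y"
  and theta_0 [simp]: "theta 0 = 0"
  and theta_1 [simp]: "theta 1 = 1"
  and theta_power: "theta (x ^ m) = theta x ^ m"
  and theta_inverse: "theta (inverse x) = inverse (theta x)"
  and theta_divide: "theta (x / y) = theta x / theta y"
  and theta_eq_0_iff [simp]: "theta x = 0 \<longleftrightarrow> x = 0"
  by (simp_all add: sz_theta_def power_mult_distrib power_inverse power_divide
        power_mult[symmetric] mult.commute)

lemma pow_card: "x ^ (2 ^ (2 * n + 1)) = (x :: 'a)"
  using finite_field_pow_card[of x] by (simp add: card_field)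

lemma power_two_power_power: "(x ^ (2 ^ i)) ^ (2 ^ j) = (x :: 'a) ^ (2 ^ (i + j))"
  by (simp add: power_mult power_add)

text \<open>The exponents satisfy \<open>2 * (n + 1) = (2 * n + 1) + 1\<close>, and raising to the
  power \<open>2 ^ (2 * n + 1)\<close> is the identity, so one squaring is left.\<close>

lemma theta_theta [simp]: "theta (theta x) = x\<^sup>2"
proof -
  have "theta (theta x) = (x ^ (2 ^ (2 * n + 1))) ^ (2 ^ 1)"
    unfolding sz_theta_def power_two_power_power by (simp add: mult_2)
  then show ?thesis by (simp only: pow_card power_one_right)
qed

text \<open>The torus element \<open>sz_M n k\<close> is reparametrised by \<open>k = theta c\<close>, so that \<open>k ^ (2 ^ n) = c\<close> and
  its entries involve no exponent depending on \<open>n\<close> other than through \<open>theta\<close>.\<close>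

definition D :: "'a \<Rightarrow> 'a ^ 4 ^ 4" where "D c = sz_M n (theta c)"

text \<open>Since \<open>n + (n + 1) = 2 * n + 1\<close>, the power map with exponent
  \<open>2 ^ n\<close> inverts \<open>theta\<close>. Hence the \<open>D c\<close> exhaust the torus
  generators.\<close>

lemma sz_M_eq_D: "sz_M n k = D (k ^ (2 ^ n))"
proof -
  have "theta (k ^ (2 ^ n)) = k ^ (2 ^ (2 * n + 1))"
    unfolding sz_theta_def power_two_power_power by (simp add: mult_2)
  then show ?thesis by (simp only: pow_card D_def)
qed

lemma D_eq: "D c = vector [
     vector [c * theta c, 0, 0, 0],
     vector [0, c, 0, 0],
     vector [0, 0, inverse c, 0],
     vector [0, 0, 0, inverse (c * theta c)]]"
proof -
  have "theta c ^ (2 ^ n) = c ^ (2 ^ (2 * n + 1))"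
    unfolding sz_theta_def power_two_power_power by (simp add: mult_2)
  then have "theta c ^ (2 ^ n) = c" by (simp only: pow_card)
  then show ?thesis by (simp add: D_def sz_M_def power_add mult.commute)
qed

section \<open>Relations between the generators\<close>

lemmas mat_simps = matrix_4_eq_iff matrix_4_mult_nth sz_T_def sz_W_def D_eq mat_def

lemma W_W: "W ** W = I" by (simp add: mat_simps)

lemma T_0_0: "T 0 0 = I" by (simp add: mat_simps)

lemma T_T: "T a b ** T c d = T (a + c) (b + d + theta a * c)"
  by (simp add: mat_simps theta_add theta_mult algebra_simps power2_eq_square)

lemma D_D: "D c ** D d = D (c * d)"
  by (simp add: mat_simps theta_mult)

lemma W_D: "W ** D c = D (inverse c) ** W"
  by (simp add: mat_simps theta_inverse)

lemma D_T: "c \<noteq> 0 \<Longrightarrow> D c ** T a b = T (a / theta c) (b / (c\<^sup>2 * theta c)) ** D c"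
  by (simp add: mat_simps theta_mult theta_inverse theta_divide theta_power field_simps power2_eq_square)


text \<open>The lower left entry of \<open>T a b\<close>.\<close>

definition N :: "'a \<Rightarrow> 'a \<Rightarrow> 'a" where "N a b = a\<^sup>2 * theta a + a * b + theta b"

text \<open>Permits division by \<open>N a b\<close> for every nontrivial \<open>T a b\<close>, as
  the relation for \<open>W ** T a b ** W\<close> requires.\<close>

lemma N_eq_0_iff: "N a b = 0 \<longleftrightarrow> a = 0 \<and> b = 0"
proof
  assume N: "N a b = 0"
  show "a = 0 \<and> b = 0"
  proof (cases "a = 0")
    case True
    with N show ?thesis by (simp add: N_def)
  next
    case False
    \<comment> \<open>With this substitution \<open>1 + c = theta c\<close>; applying \<open>theta\<close> once more gives \<open>c\<^sup>2 = c\<close>.\<close>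
    define c where "c = b / (a * theta a)"
    have b: "b = c * (a * theta a)" using False by (simp add: c_def)
    have "N a b = a\<^sup>2 * theta a * (1 + c + theta c)"
      by (simp add: N_def b theta_mult algebra_simps power2_eq_square)
    with N False have c: "1 + c = theta c" by simp
    then have "theta (1 + c) = c\<^sup>2" by simp
    then have "1 + theta c = c\<^sup>2" by (simp only: theta_add theta_1)
    with c have "c * c = c * 1" by (metis add_self_left power2_eq_square mult_1_right)
    then have "c = 0 \<or> c = 1" by (metis mult_left_cancel)
    \<comment> \<open>\<open>1 + c = theta c\<close> fails for both values, as \<open>theta\<close>
      fixes 0 and 1.\<close>
    with c show ?thesis by auto
  qed
qed (simp add: N_def)

text \<open>The parameters on the right are read off from the first row and the last column:
  left multiplication by \<open>T\<close> fixes the former, right multiplication the latter.\<close>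

lemma W_T_W:
  assumes "N a b \<noteq> 0"
  shows "W ** T a b ** W = T (b / N a b) (a / N a b) ** D (theta (N a b) / N a b) ** W **
    T ((a * theta a + b) / N a b) (b / theta (N a b))"
proof -
  define f A B F where "f = N a b" and "A = theta a" and "B = theta b" and "F = theta f"
  have f: "f = a * a * A + a * b + B" by (simp add: f_def N_def A_def B_def power2_eq_square)
  have F: "F = A * A * a * a + A * B + b * b"
    by (simp add: F_def f theta_add theta_mult A_def B_def power2_eq_square)
  have th: "theta a = A" "theta b = B" "theta f = F" "theta A = a * a" "theta B = b * b" "theta F = f * f"
    by (simp_all add: A_def B_def F_def power2_eq_square)
  have nz [simp]: "f \<noteq> 0" "F \<noteq> 0" using assms by (simp_all add: f_def F_def)
  define x y z w where "x = b / f" and "y = a / f" and "z = (a * A + b) / f" and "w = b / F"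
  define X Y Z V where "X = B / F" and "Y = A / F" and "Z = (A * (a * a) + B) / F" and "V = B / (f * f)"
  note xyzw = x_def y_def z_def w_def X_def Y_def Z_def V_def
  have XYZW: "theta x = X" "theta y = Y" "theta z = Z" "theta w = V"
    by (simp_all add: xyzw theta_divide theta_add theta_mult th)
  \<comment> \<open>From here on the last-row entries of the two unipotent factors in columns 2 and
    1 are simplified.\<close>
  have *: "x * X + y = (a * F + b * B) / (f * F)"
    by (simp add: xyzw field_simps)
  have "z * Z + w = ((a * A + b) * (A * (a * a) + B) + b * f) / (f * F)"
    by (simp add: xyzw field_simps)
  also have "(a * A + b) * (A * (a * a) + B) + b * f = a * F"
    by (simp add: f F algebra_simps)
  finally have 1: "z * Z + w = a / f" by simp
  have 2: "x * x * X + x * y + Y = 1 / f"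
  proof -
    have "x * x * X + x * y + Y = (b * b * B + a * b * F + A * f * f) / (f * f * F)"
      by (simp add: xyzw field_simps)
    also have "b * b * B + a * b * F + A * f * f = f * F"
      by (simp add: f F algebra_simps)
    finally show ?thesis by simp
  qed
  have 3: "z * z * Z + z * w + V = 1 / f"
  proof -
    have "z * z * Z + z * w + V = z * (z * Z + w) + V" by (simp add: algebra_simps)
    also have "\<dots> = (a * (a * A + b) + B) / (f * f)" by (simp only: 1) (simp add: xyzw field_simps)
    also have "a * (a * A + b) + B = f" by (simp add: f algebra_simps)
    finally show ?thesis by simp
  qed
  show ?thesis
    unfolding f_def[symmetric] F_def[symmetric]
    unfolding A_def[symmetric] x_def[symmetric] y_def[symmetric] z_def[symmetric] w_def[symmetric]
    apply (simp add: mat_simps theta_mult theta_divide th XYZW power2_eq_square 1 2 3)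
    apply (intro conjI)
                apply (unfold * xyzw)
                apply (simp_all add: divide_simps)
         apply (simp_all add: f F algebra_simps)
    done
qed

section \<open>Closure under products and inverses\<close>

lemma T_inj: "T a b = T c d \<longleftrightarrow> a = c \<and> b = d"
proof
  assume eq: "T a b = T c d"
  have "T a b $ 2 $ 1 = a" "T a b $ 3 $ 1 = b" "T c d $ 2 $ 1 = c" "T c d $ 3 $ 1 = d"
    by (simp_all add: sz_T_def)
  with eq show "a = c \<and> b = d" by simp
qed simp

lemma D_1: "D 1 = I"
  by (simp add: mat_simps)

lemma T_inverse: "T a b ** T a (b + theta a * a) = I" "T a (b + theta a * a) ** T a b = I"
  by (simp_all add: T_T T_0_0 algebra_simps)

lemma D_inverse: "c \<noteq> 0 \<Longrightarrow> D c ** D (inverse c) = I" "c \<noteq> 0 \<Longrightarrow> D (inverse c) ** D c = I"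
  by (simp_all add: D_D D_1)

lemma D_cancel_right: "c \<noteq> 0 \<Longrightarrow> A ** D c = B ** D c \<longleftrightarrow> A = B"
  by (metis D_inverse(1) matrix_mul_assoc matrix_mul_rid)

text \<open>Induction on the right factor \<open>h\<close>, since the closure appends generators on
  the right.\<close>

lemma mult_G: "h \<in> G \<Longrightarrow> g \<in> G \<Longrightarrow> g ** h \<in> G"
  by (induction rule: suzuki_group.induct)
     (auto simp: matrix_mul_assoc intro: suzuki_group.intros)

lemma T_in_G: "T a b \<in> G"
  using suzuki_group.T[OF suzuki_group.one] by simp

lemma D_in_G: "c \<noteq> 0 \<Longrightarrow> D c \<in> G"
  using suzuki_group.M[OF suzuki_group.one, of "theta c"] by (simp add: D_def)

lemma W_in_G: "W \<in> G"
  using suzuki_group.W[OF suzuki_group.one] by simp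

text \<open>Each generator has an inverse in \<open>G\<close>; that of \<open>g ** s\<close> is the
  inverse of \<open>s\<close> times the inverse of \<open>g\<close>.\<close>

lemma G_inverse: "g \<in> G \<Longrightarrow> \<exists>h\<in>G. g ** h = I \<and> h ** g = I"
proof -
  have step: "\<exists>h\<in>G. (g ** s) ** h = I \<and> h ** (g ** s) = I"
    if "\<exists>h\<in>G. g ** h = I \<and> h ** g = I" "s' \<in> G" "s ** s' = I" "s' ** s = I" for g s s'
  proof -
    from that(1) obtain h where h: "h \<in> G" "g ** h = I" "h ** g = I" by blast
    have "g ** s ** (s' ** h) = g ** (s ** s') ** h" "s' ** h ** (g ** s) = s' ** (h ** g) ** s"
      by (simp_all add: matrix_mul_assoc)
    then show ?thesis
      using h that by (intro bexI[of _ "s' ** h"]) (simp_all add: mult_G)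
  qed
  show "\<exists>h\<in>G. g ** h = I \<and> h ** g = I" if "g \<in> G"
    using that
  proof (induction rule: suzuki_group.induct)
    case one
    show ?case by (rule bexI[of _ I]) (auto intro: suzuki_group.one)
  next
    case (T g a b)
    show ?case by (rule step[OF T.IH T_in_G T_inverse])
  next
    case (M g k)
    then have "k ^ (2 ^ n) \<noteq> 0" by simp
    with M.IH show ?case
      unfolding sz_M_eq_D by (intro step[OF _ D_in_G D_inverse]) simp_all
  next
    case (W g)
    show ?case by (rule step[OF W.IH W_in_G W_W W_W])
  qed
qed

section \<open>The Bruhat decomposition\<close>

definition Borel :: "('a ^ 4 ^ 4) set" where
  "Borel = {T a b ** D c | a b c. c \<noteq> 0}"

text \<open>The torus appears only to the left of \<open>W\<close>, because a diagonal factor passes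
  through \<open>W\<close> up to inversion.\<close>

definition big_cell :: "('a ^ 4 ^ 4) set" where
  "big_cell = {T a b ** D c ** W ** T p q | a b c p q. c \<noteq> 0}"

lemma BorelI: "c \<noteq> 0 \<Longrightarrow> T a b ** D c \<in> Borel"
  unfolding Borel_def by blast

lemma BorelE:
  assumes "g \<in> Borel"
  obtains a b c where "g = T a b ** D c" "c \<noteq> 0"
  using assms unfolding Borel_def by blast

lemma T_in_Borel: "T a b \<in> Borel"
  using BorelI[of 1 a b] by (simp add: D_1)

lemma D_T_eq: "c \<noteq> 0 \<Longrightarrow> \<exists>a' b'. D c ** T a b = T a' b' ** D c"
  using D_T by blast

lemma T_D_eq: "c \<noteq> 0 \<Longrightarrow> \<exists>a' b'. T a b ** D c = D c ** T a' b'"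
proof -
  assume c: "c \<noteq> 0"
  then obtain a' b' where "D (inverse c) ** T a b = T a' b' ** D (inverse c)"
    using D_T_eq[of "inverse c" a b] by auto
  then have "D c ** (D (inverse c) ** T a b) ** D c = D c ** (T a' b' ** D (inverse c)) ** D c"
    by simp
  then have "(D c ** D (inverse c)) ** T a b ** D c = D c ** T a' b' ** (D (inverse c) ** D c)"
    by (simp only: matrix_mul_assoc)
  then have "T a b ** D c = D c ** T a' b'" using c by (simp add: D_inverse)
  then show ?thesis by blast
qed

lemma Borel_mult: "g \<in> Borel \<Longrightarrow> h \<in> Borel \<Longrightarrow> g ** h \<in> Borel"
proof -
  assume "g \<in> Borel" "h \<in> Borel"
  then obtain a b c p q d where g: "g = T a b ** D c" "c \<noteq> 0" and h: "h = T p q ** D d" "d \<noteq> 0"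
    by (metis BorelE)
  obtain p' q' where pq: "D c ** T p q = T p' q' ** D c" using D_T_eq[OF g(2)] by blast
  have "g ** h = T a b ** (D c ** T p q) ** D d" by (simp add: g h matrix_mul_assoc)
  also have "\<dots> = (T a b ** T p' q') ** (D c ** D d)" unfolding pq by (simp add: matrix_mul_assoc)
  finally show ?thesis using g(2) h(2) unfolding T_T D_D by (simp add: BorelI)
qed

lemma D_in_Borel: "c \<noteq> 0 \<Longrightarrow> D c \<in> Borel"
  using BorelI[of c 0 0] by (simp add: T_0_0)

lemma big_cell_eq: "big_cell = {h ** W ** T p q | h p q. h \<in> Borel}"
  unfolding big_cell_def Borel_def by blast

lemma big_cellI: "h \<in> Borel \<Longrightarrow> h ** W ** T p q \<in> big_cell"
  unfolding big_cell_eq by blast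

lemma big_cellE:
  assumes "g \<in> big_cell"
  obtains h p q where "g = h ** W ** T p q" "h \<in> Borel"
  using assms unfolding big_cell_eq by blast

text \<open>The diagonal part of \<open>h\<close> moves left past the unipotent factor, is inverted
  by \<open>W\<close>, and is absorbed by the Borel part of \<open>g\<close>.\<close>

lemma big_cell_mult_Borel: "g \<in> big_cell \<Longrightarrow> h \<in> Borel \<Longrightarrow> g ** h \<in> big_cell"
proof -
  assume "g \<in> big_cell" "h \<in> Borel"
  then obtain k p q a b c where g: "g = k ** W ** T p q" "k \<in> Borel" and h: "h = T a b ** D c" "c \<noteq> 0"
    by (metis big_cellE BorelE)
  obtain u v where uv: "T p q ** T a b ** D c = D c ** T u v"
    using T_D_eq[OF h(2)] unfolding T_T by blast
  have "g ** h = k ** W ** (T p q ** T a b ** D c)" by (simp add: g h matrix_mul_assoc)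
  also have "\<dots> = k ** (W ** D c) ** T u v" unfolding uv by (simp add: matrix_mul_assoc)
  also have "\<dots> = (k ** D (inverse c)) ** W ** T u v" unfolding W_D by (simp add: matrix_mul_assoc)
  finally have "g ** h = (k ** D (inverse c)) ** W ** T u v" .
  moreover have "k ** D (inverse c) \<in> Borel" using g(2) h(2) by (simp add: Borel_mult D_in_Borel)
  ultimately show ?thesis by (simp add: big_cellI)
qed

text \<open>Both cells are stable under the generators \<open>T\<close> and \<open>sz_M\<close>. For
  a factor \<open>W\<close> after the big cell, \<open>W ** T p q ** W\<close> is either the
  identity or in the big cell again.\<close>

lemma bruhat: "g \<in> G \<Longrightarrow> g \<in> Borel \<union> big_cell"
proof (induction rule: suzuki_group.induct)
  case one
  show ?case using T_in_Borel[of 0 0] by (simp add: T_0_0)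
next
  case (T g a b)
  then show ?case using T_in_Borel Borel_mult big_cell_mult_Borel by blast
next
  case (M g k)
  then have "sz_M n k \<in> Borel" unfolding sz_M_eq_D by (intro D_in_Borel) simp
  with M show ?case using Borel_mult big_cell_mult_Borel by blast
next
  case (W g)
  from W.IH show ?case
  proof
    assume "g \<in> Borel"
    then have "g ** W ** T 0 0 \<in> big_cell" by (rule big_cellI)
    then show ?thesis by (simp add: T_0_0)
  next
    assume "g \<in> big_cell"
    then obtain h p q where g: "g = h ** W ** T p q" "h \<in> Borel" by (rule big_cellE)
    show ?thesis
    proof (cases "N p q = 0")
      case True
      then have "g ** W = h ** (W ** W)" by (simp add: N_eq_0_iff g T_0_0 matrix_mul_assoc)
      then show ?thesis using g by (simp add: W_W)
    next
      case False
      then obtain a b c u v where *: "W ** T p q ** W = T a b ** D c ** W ** T u v" "c \<noteq> 0"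
        using W_T_W[OF False] by (metis divide_eq_0_iff theta_eq_0_iff)
      have "g ** W = h ** (W ** T p q ** W)" by (simp add: g matrix_mul_assoc)
      also have "\<dots> = (h ** (T a b ** D c)) ** W ** T u v" unfolding * by (simp add: matrix_mul_assoc)
      finally have "g ** W = (h ** (T a b ** D c)) ** W ** T u v" .
      moreover have "h ** (T a b ** D c) \<in> Borel"
        using g(2) *(2) by (intro Borel_mult BorelI)
      ultimately show ?thesis by (simp add: big_cellI)
    qed
  qed
qed

text \<open>In the big cell the first row of \<open>g\<close> is a nonzero multiple of the last row
  of its right factor \<open>T p q\<close>. Left multiplication by \<open>T c d\<close> keeps the
  first row, so right multiplication by \<open>T a b\<close> must fix that last row, which forces
  \<open>a = b = 0\<close>.\<close>

lemma conj_T_imp_Borel: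
  assumes "g \<in> G" and conj: "g ** T a b = T c d ** g" and nontrivial: "T a b \<noteq> I"
  shows "g \<in> Borel"
proof (rule ccontr)
  assume "g \<notin> Borel"
  with bruhat[OF assms(1)] obtain s t e p q
    where g: "g = T s t ** D e ** W ** T p q" and e: "e \<noteq> 0"
    by (auto simp: big_cell_def)
  have row: "(T x y ** D e ** W ** T u v) $ 1 $ j = e * theta e * T u v $ 4 $ j" for x y u v j
    by (simp add: mat_simps)
  have "T s t ** D e ** W ** (T p q ** T a b) = (T c d ** T s t) ** D e ** W ** T p q"
    using conj by (simp add: g matrix_mul_assoc)
  then have "e * theta e * T (p + a) (q + b + theta p * a) $ 4 $ j = e * theta e * T p q $ 4 $ j" for j
    unfolding T_T by (metis row)
  then have eq: "T (p + a) (q + b + theta p * a) $ 4 $ j = T p q $ 4 $ j" for j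
    using e by simp
  have a: "a = 0" using eq[of 3] by (simp add: sz_T_def)
  have "b = 0" using eq[of 2] by (simp add: sz_T_def a)
  with a nontrivial show False by (simp add: T_0_0)
qed

section \<open>The single class of involutions\<close>

definition invols :: "('a ^ 4 ^ 4) set" where
  "invols = {g \<in> G. g \<noteq> I \<and> g ** g = I}"

text \<open>The diagonal gives \<open>c * c = 1\<close>, hence \<open>c = 1\<close> in
  characteristic two; then \<open>theta a * a = 0\<close>. The identity is included as
  \<open>b = 0\<close>.\<close>

lemma Borel_involution:
  assumes "g \<in> Borel" "g ** g = I"
  shows "\<exists>b. g = T 0 b"
proof -
  from assms(1) obtain a b c where g: "g = T a b ** D c" "c \<noteq> 0" by (rule BorelE)
  have "(g ** g) $ 2 $ 2 = c * c" by (simp add: g mat_simps)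
  with assms(2) have "c * c = 1" by (simp add: mat_def)
  then have "(c + 1) * (c + 1) = 0" by (simp add: algebra_simps)
  then have "c = 1" by simp
  then have g': "g = T a b" by (simp add: g D_1)
  with assms(2) have "T 0 (theta a * a) = T 0 0" by (simp add: T_T T_0_0)
  then have "a = 0" by (auto simp: T_inj)
  with g' show ?thesis by blast
qed

lemma D_conj_T_0:
  assumes "b \<noteq> 0"
  shows "\<exists>c. c \<noteq> 0 \<and> D c ** T 0 b = T 0 1 ** D c"
proof -
  \<comment> \<open>Needed is \<open>c\<close> with \<open>c\<^sup>2 * theta c = b\<close>. With
    \<open>k = theta c\<close> this reads \<open>theta k * k = b\<close>, solved by
    \<open>theta b / b\<close>; the power \<open>2 ^ n\<close> then undoes
    \<open>theta\<close>.\<close>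
  define k where "k = theta b / b"
  define c where "c = k ^ (2 ^ n)"
  have "theta c = k ^ (2 ^ (2 * n + 1))"
    unfolding sz_theta_def c_def power_two_power_power by (simp add: mult_2)
  then have tc: "theta c = k" by (simp only: pow_card)
  then have c2: "c\<^sup>2 = theta k" by (metis theta_theta)
  have "k \<noteq> 0" using assms by (simp add: k_def)
  then have "c \<noteq> 0" by (simp add: c_def)
  moreover have "c\<^sup>2 * theta c = b"
    unfolding c2 tc using assms by (simp add: k_def theta_divide power2_eq_square)
  ultimately show ?thesis
    using D_T[of c 0 b] assms by (intro exI[of _ c]) simp
qed

definition conjugate :: "'a ^ 4 ^ 4 \<Rightarrow> 'a ^ 4 ^ 4 \<Rightarrow> bool" where
  "conjugate g g' \<longleftrightarrow> (\<exists>h\<in>G. h ** g = g' ** h)"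

lemma conjugateI: "h \<in> G \<Longrightarrow> h ** g = g' ** h \<Longrightarrow> conjugate g g'"
  unfolding conjugate_def by blast

lemma conjugate_trans:
  assumes "conjugate g g'" "conjugate g' g''"
  shows "conjugate g g''"
proof -
  from assms obtain h k where h: "h \<in> G" "h ** g = g' ** h" and k: "k \<in> G" "k ** g' = g'' ** k"
    unfolding conjugate_def by blast
  have "(k ** h) ** g = k ** (h ** g)" by (simp add: matrix_mul_assoc)
  also have "\<dots> = (k ** g') ** h" by (simp add: h matrix_mul_assoc)
  also have "\<dots> = g'' ** (k ** h)" by (simp add: k matrix_mul_assoc)
  finally show ?thesis using h k by (intro conjugateI[of "k ** h"]) (simp_all add: mult_G)
qed

lemma conjugate_sym:
  assumes "conjugate g g'"
  shows "conjugate g' g"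
proof -
  from assms obtain h where h: "h \<in> G" "h ** g = g' ** h"
    unfolding conjugate_def by blast
  obtain k where k: "k \<in> G" "h ** k = I" "k ** h = I" using G_inverse[OF h(1)] by blast
  have "k ** g' = k ** (g' ** h) ** k" by (simp add: k(2) flip: matrix_mul_assoc)
  also have "\<dots> = (k ** h) ** g ** k" by (simp add: h(2)[symmetric] matrix_mul_assoc)
  finally show ?thesis using k by (intro conjugateI[of k]) simp_all
qed

lemma conjugate_D_W:
  assumes "c \<noteq> 0"
  shows "conjugate (D c ** W) (T 0 1)"
proof -
  \<comment> \<open>A square root of \<open>c\<close>: doubling the exponent gives the identity
    power map. Conjugation by \<open>D (inverse l)\<close> then turns \<open>D c ** W\<close> into
    \<open>W\<close>.\<close>
  define l where "l = c ^ (2 ^ (2 * n))"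
  have l: "l \<noteq> 0" using assms by (simp add: l_def)
  have "l * l = c ^ (2 ^ (2 * n + 1))" by (simp add: l_def mult_2 power_add)
  then have ll: "l * l = c" by (simp only: pow_card)
  have "D (inverse l) ** (D c ** W) = D (inverse l * (l * l)) ** W"
    by (simp add: matrix_mul_assoc D_D ll)
  also have "inverse l * (l * l) = l" using l by simp
  also have "D l ** W = W ** D (inverse l)" by (simp add: W_D)
  finally have 1: "conjugate (D c ** W) W" using l by (intro conjugateI[OF D_in_G]) simp_all
  \<comment> \<open>This instance of the Bruhat relation has trivial torus part and says that
    \<open>W ** T 1 0\<close> conjugates \<open>W\<close> to \<open>T 0 1\<close>.\<close>
  have "W ** T 1 0 ** W = T 0 1 ** W ** T 1 0"
    using W_T_W[of 1 0] by (simp add: N_def D_1)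
  then have "conjugate W (T 0 1)"
    by (intro conjugateI[of "W ** T 1 0"]) (simp_all add: matrix_mul_assoc mult_G W_in_G T_in_G)
  with 1 show ?thesis by (rule conjugate_trans)
qed

text \<open>Outside the Borel subgroup, conjugation by \<open>T p q\<close> collects the unipotent
  factors on the left, giving \<open>T x y ** D c ** W\<close>. The upper right entry of its square
  is a nonzero multiple of \<open>N x y\<close>, so \<open>T x y\<close> is trivial.\<close>

lemma conjugate_T_0_1:
  assumes "g \<in> invols"
  shows "conjugate g (T 0 1)"
proof (cases "g \<in> Borel")
  case True
  with assms obtain b where g: "g = T 0 b" using Borel_involution by (auto simp: invols_def)
  with assms have "b \<noteq> 0" by (auto simp: invols_def T_0_0)
  with D_conj_T_0 obtain c where "c \<noteq> 0" "D c ** T 0 b = T 0 1 ** D c" by blast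
  then show ?thesis unfolding g by (intro conjugateI[OF D_in_G])
next
  case False
  with assms bruhat have "g \<in> big_cell" by (auto simp: invols_def)
  then obtain a b c p q where g: "g = T a b ** D c ** W ** T p q" and c: "c \<noteq> 0"
    by (auto simp: big_cell_def)
  define x y where "x = p + a" and "y = q + b + theta p * a"
  define h where "h = T x y ** D c ** W"
  have hT: "T p q ** g = h ** T p q"
    unfolding g h_def x_def y_def T_T[symmetric] by (simp only: matrix_mul_assoc)
  have "(h ** h) ** T p q = h ** (T p q ** g)" by (simp add: hT matrix_mul_assoc)
  also have "\<dots> = T p q ** (g ** g)" by (simp add: hT[symmetric] matrix_mul_assoc)
  also have "\<dots> = T p q" using assms by (simp add: invols_def)
  finally have "h ** h = I"
    by (metis T_inverse(1) matrix_mul_assoc matrix_mul_rid)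
  then have "(h ** h) $ 1 $ 4 = 0" by (simp add: mat_def)
  moreover have "(h ** h) $ 1 $ 4 = (c * theta c)\<^sup>2 * N x y"
    by (simp add: h_def mat_simps N_def power2_eq_square)
  ultimately have "N x y = 0" using c by simp
  then have "h = D c ** W" by (simp add: h_def N_eq_0_iff T_0_0)
  with hT have "conjugate g (D c ** W)" by (intro conjugateI[OF T_in_G]) auto
  then show ?thesis using conjugate_D_W[OF c] by (rule conjugate_trans)
qed

lemma conj_class_eq_invols:
  assumes t: "t \<in> invols"
  shows "conj_class (**) G t = invols"
proof (intro set_eqI iffI)
  fix y assume "y \<in> conj_class (**) G t"
  then obtain x where x: "x \<in> G" "y ** x = x ** t" and y: "y \<in> G" by (auto simp: conj_class_def)
  obtain k where k: "x ** k = I" "k ** x = I" using G_inverse[OF x(1)] by blast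
  have yk: "y = x ** t ** k" using x(2) k by (metis matrix_mul_assoc matrix_mul_rid)
  have "y \<noteq> I"
  proof
    assume "y = I"
    with x have "x ** t = x ** I" by simp
    then have "t = I" using k by (metis matrix_mul_assoc matrix_mul_lid)
    with t show False by (simp add: invols_def)
  qed
  moreover have "y ** y = I"
  proof -
    have "y ** y = y ** x ** t ** k" by (subst (2) yk) (simp add: matrix_mul_assoc)
    also have "\<dots> = x ** (t ** t) ** k" by (simp add: x(2) matrix_mul_assoc)
    also have "\<dots> = I" using t k by (simp add: invols_def)
    finally show ?thesis .
  qed
  ultimately show "y \<in> invols" using y by (simp add: invols_def)
next
  fix y assume y: "y \<in> invols"
  have "conjugate t y"
    using conjugate_trans[OF conjugate_T_0_1[OF t] conjugate_sym[OF conjugate_T_0_1[OF y]]] .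
  with y show "y \<in> conj_class (**) G t"
    unfolding conj_class_def conjugate_def invols_def by (simp only: mem_Collect_eq) metis
qed

section \<open>Transport by conjugation\<close>

lemma conj_mult:
  fixes x y h k :: "'a ^ 4 ^ 4"
  assumes "k ** h = I"
  shows "(h ** x ** k) ** (h ** y ** k) = h ** (x ** y) ** k"
proof -
  have "(h ** x ** k) ** (h ** y ** k) = h ** x ** (k ** h) ** y ** k"
    by (simp only: matrix_mul_assoc)
  then show ?thesis by (simp add: assms matrix_mul_assoc)
qed

lemma conj_cancel:
  fixes x h k :: "'a ^ 4 ^ 4"
  assumes "k ** h = I"
  shows "k ** (h ** x ** k) ** h = x"
proof -
  have "k ** (h ** x ** k) ** h = (k ** h) ** x ** (k ** h)"
    by (simp only: matrix_mul_assoc)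
  then show ?thesis by (simp add: assms)
qed

lemma conj_eq_iff:
  fixes x y h k :: "'a ^ 4 ^ 4"
  assumes "k ** h = I"
  shows "h ** x ** k = h ** y ** k \<longleftrightarrow> x = y"
  by (metis conj_cancel[OF assms])

lemma conj_commute_iff:
  fixes x y h k :: "'a ^ 4 ^ 4"
  assumes "k ** h = I"
  shows "(h ** x ** k) ** (h ** y ** k) = (h ** y ** k) ** (h ** x ** k) \<longleftrightarrow> x ** y = y ** x"
  by (simp only: conj_mult[OF assms] conj_eq_iff[OF assms])

lemma conj_invols:
  assumes "x \<in> invols" "h \<in> G" "k \<in> G" "h ** k = I" "k ** h = I"
  shows "h ** x ** k \<in> invols"
proof -
  have "h ** x ** k \<noteq> I"
    using conj_eq_iff[OF assms(5), of x I] assms by (auto simp: invols_def)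
  moreover have "(h ** x ** k) ** (h ** x ** k) = I"
    using assms by (simp only: conj_mult[OF assms(5)]) (simp add: invols_def)
  ultimately show ?thesis using assms by (auto simp: invols_def mult_G)
qed

lemma obtain_conj_T_0_1:
  assumes "z \<in> invols"
  obtains h k where "h \<in> G" "k \<in> G" "h ** k = I" "k ** h = I" "h ** z ** k = T 0 1"
proof -
  obtain h where h: "h \<in> G" "h ** z = T 0 1 ** h"
    using conjugate_T_0_1[OF assms] by (auto simp: conjugate_def)
  obtain k where k: "k \<in> G" "h ** k = I" "k ** h = I" using G_inverse[OF h(1)] by blast
  have "h ** z ** k = T 0 1" using k by (simp add: h(2) flip: matrix_mul_assoc)
  with h k that show ?thesis by blast
qed

section \<open>Commuting involutions and centralizers\<close>

lemma T_0_in_invols_iff: "T 0 b \<in> invols \<longleftrightarrow> b \<noteq> 0"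
  unfolding invols_def by (auto simp: T_in_G T_T T_0_0 T_inj simp flip: T_0_0)

lemma commute_T_0_1_iff:
  assumes "x \<in> invols"
  shows "x ** T 0 1 = T 0 1 ** x \<longleftrightarrow> (\<exists>b. x = T 0 b)"
proof
  assume "x ** T 0 1 = T 0 1 ** x"
  moreover have "T 0 1 \<noteq> I" by (simp add: T_inj flip: T_0_0)
  ultimately have "x \<in> Borel" using assms conj_T_imp_Borel by (auto simp: invols_def)
  then show "\<exists>b. x = T 0 b" using assms Borel_involution by (auto simp: invols_def)
qed (auto simp: T_T add.commute)

text \<open>After conjugating \<open>y\<close> to \<open>T 0 1\<close>, the other two lie in the
  abelian group of the \<open>T 0 b\<close>.\<close>

lemma invols_commute_trans:
  assumes "x \<in> invols" "y \<in> invols" "z \<in> invols" "x ** y = y ** x" "y ** z = z ** y"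
  shows "x ** z = z ** x"
proof -
  obtain h k where hk: "h \<in> G" "k \<in> G" "h ** k = I" "k ** h = I" and y: "h ** y ** k = T 0 1"
    using obtain_conj_T_0_1[OF assms(2)] .
  have "(h ** x ** k) ** T 0 1 = T 0 1 ** (h ** x ** k)" "(h ** z ** k) ** T 0 1 = T 0 1 ** (h ** z ** k)"
    unfolding y[symmetric] conj_commute_iff[OF hk(4)] by (simp_all add: assms)
  then obtain a b where "h ** x ** k = T 0 a" "h ** z ** k = T 0 b"
    using commute_T_0_1_iff conj_invols[OF _ hk] assms by metis
  then have "(h ** x ** k) ** (h ** z ** k) = (h ** z ** k) ** (h ** x ** k)"
    by (simp add: T_T add.commute)
  then show ?thesis by (simp only: conj_commute_iff[OF hk(4)])
qed

lemma card_commuting_invols: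
  assumes "z \<in> invols"
  shows "card {c \<in> invols. z ** c = c ** z} = card {c \<in> invols. T 0 1 ** c = c ** T 0 1}"
proof -
  obtain h k where hk: "h \<in> G" "k \<in> G" "h ** k = I" "k ** h = I" and z: "h ** z ** k = T 0 1"
    using obtain_conj_T_0_1[OF assms] .
  have z': "k ** T 0 1 ** h = z" using conj_cancel[OF hk(4)] z by metis
  have "bij_betw (\<lambda>x. h ** x ** k) {c \<in> invols. z ** c = c ** z} {c \<in> invols. T 0 1 ** c = c ** T 0 1}"
  proof (rule bij_betw_byWitness[where f' = "\<lambda>x. k ** x ** h"])
    show "(\<lambda>x. h ** x ** k) ` {c \<in> invols. z ** c = c ** z} \<subseteq> {c \<in> invols. T 0 1 ** c = c ** T 0 1}"
      unfolding z[symmetric] by (auto simp: conj_commute_iff hk conj_invols)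
    show "(\<lambda>x. k ** x ** h) ` {c \<in> invols. T 0 1 ** c = c ** T 0 1} \<subseteq> {c \<in> invols. z ** c = c ** z}"
      unfolding z'[symmetric] by (auto simp: conj_commute_iff hk conj_invols)
  qed (simp_all add: conj_cancel hk)
  then show ?thesis by (rule bij_betw_same_card)
qed

lemma centralizer_T_0_1:
  assumes "g \<in> G" "g ** T 0 1 = T 0 1 ** g"
  shows "\<exists>p q. g = T p q"
proof -
  have "T 0 1 \<noteq> I" by (simp add: T_inj flip: T_0_0)
  with assms have "g \<in> Borel" using conj_T_imp_Borel by blast
  then obtain a b c where g: "g = T a b ** D c" and c: "c \<noteq> 0" by (rule BorelE)
  have "T a b ** (D c ** T 0 1) = T 0 1 ** T a b ** D c"
    using assms(2) by (simp add: g matrix_mul_assoc)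
  then have "T a b ** T 0 (1 / (c\<^sup>2 * theta c)) ** D c = T 0 1 ** T a b ** D c"
    by (simp add: D_T[OF c] matrix_mul_assoc)
  then have "b + 1 / (c\<^sup>2 * theta c) = 1 + b"
    unfolding D_cancel_right[OF c] by (simp add: T_T T_inj)
  then have "1 / (c\<^sup>2 * theta c) = 1" by (metis add.commute add_left_cancel)
  then have 1: "c\<^sup>2 * theta c = 1" by simp
  \<comment> \<open>Applying \<open>theta\<close> to \<open>c\<^sup>2 * theta c = 1\<close> gives a
    second equation, from which \<open>theta c * c = 1\<close>; comparing with the first yields
    \<open>c = 1\<close>.\<close>
  have "(theta c)\<^sup>2 * c\<^sup>2 = 1"
  proof -
    have "theta (c\<^sup>2 * theta c) = theta 1" by (simp only: 1)
    then show ?thesis by (simp add: theta_mult theta_power)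
  qed
  then have "(theta c * c + 1) * (theta c * c + 1) = 0"
    by (simp add: algebra_simps power2_eq_square)
  then have 2: "theta c * c = 1" by simp
  have "c\<^sup>2 * theta c = c * (theta c * c)" by (simp add: power2_eq_square)
  with 1 2 have "c = 1" by simp
  then show ?thesis by (auto simp: g D_1)
qed

lemma centralizer_of_product:
  assumes x: "x \<in> invols" and a: "a \<in> invols" and b: "b \<in> invols"
    and comm: "x ** (a ** b) = (a ** b) ** x" and "a \<noteq> b"
  shows "a ** b = b ** a"
proof -
  obtain h k where hk: "h \<in> G" "k \<in> G" "h ** k = I" "k ** h = I" and hx: "h ** x ** k = T 0 1"
    using obtain_conj_T_0_1[OF x] .
  define a' b' where "a' = h ** a ** k" and "b' = h ** b ** k"
  have ab': "a' \<in> invols" "b' \<in> invols"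
    unfolding a'_def b'_def using a b hk by (simp_all add: conj_invols)
  then have sq: "a' ** a' = I" "b' ** b' = I" and G: "a' \<in> G" "b' \<in> G" by (auto simp: invols_def)
  have "a' \<noteq> b'" unfolding a'_def b'_def using \<open>a \<noteq> b\<close> by (simp add: conj_eq_iff[OF hk(4)])
  have "(a' ** b') ** T 0 1 = T 0 1 ** (a' ** b')"
    unfolding hx[symmetric] a'_def b'_def conj_mult[OF hk(4)] by (simp add: comm)
  then obtain p q where pq: "a' ** b' = T p q"
    using centralizer_T_0_1 mult_G G by blast
  have b': "b' = a' ** T p q" by (simp add: pq[symmetric] matrix_mul_assoc sq)
  have "T p q ** (b' ** a') = a' ** (b' ** b') ** a'" by (simp add: pq[symmetric] matrix_mul_assoc)
  then have "T p q ** (b' ** a') = I" by (simp add: sq)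
  \<comment> \<open>For involutions, \<open>b' ** a'\<close> is the inverse of
    \<open>a' ** b'\<close>; thus \<open>a'\<close> conjugates \<open>T p q\<close> to its
    inverse.\<close>
  then have ba: "b' ** a' = T p (q + theta p * p)"
    by (metis T_inverse(2) matrix_mul_assoc matrix_mul_lid matrix_mul_rid)
  have "T p (q + theta p * p) ** a' = b' ** (a' ** a')" by (simp add: ba[symmetric] matrix_mul_assoc)
  then have "a' ** T p q = T p (q + theta p * p) ** a'" by (simp add: sq b')
  \<comment> \<open>Here \<open>a\<close> and \<open>b\<close> being distinct enters: a trivial
    product of involutions would make them equal.\<close>
  moreover have "T p q \<noteq> I"
  proof
    assume "T p q = I"
    then show False using b' \<open>a' \<noteq> b'\<close> by simp
  qed
  ultimately have "a' \<in> Borel" using conj_T_imp_Borel G by blast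
  moreover have "b' \<in> Borel" unfolding b' using calculation by (simp add: Borel_mult T_in_Borel)
  ultimately obtain u v where "a' = T 0 u" "b' = T 0 v" using Borel_involution sq by metis
  then have "a' ** b' = b' ** a'" by (simp add: T_T add.commute)
  then show ?thesis unfolding a'_def b'_def by (simp only: conj_commute_iff[OF hk(4)])
qed

text \<open>Reduces a Killing form entry at distinct commuting \<open>a\<close>, \<open>b\<close> to
  counting the involutions that commute with one involution.\<close>

lemma mult_commuting_invols:
  assumes "a \<in> invols" "b \<in> invols" "a ** b = b ** a" "a \<noteq> b"
  shows "a ** b \<in> invols"
proof -
  have "(a ** b) ** (a ** b) = a ** (b ** b) ** a" by (simp add: assms(3) matrix_mul_assoc)
  then have "(a ** b) ** (a ** b) = I" using assms by (simp add: invols_def)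
  moreover have "a ** b \<noteq> I"
  proof
    assume "a ** b = I"
    then have "a ** a ** b = a" by (simp flip: matrix_mul_assoc)
    with assms show False by (simp add: invols_def)
  qed
  ultimately show ?thesis using assms by (simp add: invols_def mult_G)
qed

section \<open>The Killing graph and the Killing form\<close>

lemma killing_adj_invols: "killing_adj (**) G invols a b \<longleftrightarrow> commuting_adj (**) invols a b"
proof
  assume "killing_adj (**) G invols a b"
  then show "commuting_adj (**) invols a b"
    unfolding killing_adj_def commuting_adj_def using centralizer_of_product by blast
next
  assume ab: "commuting_adj (**) invols a b"
  \<comment> \<open>The involution \<open>a\<close> itself witnesses that the centralizer of
    \<open>a ** b\<close> meets the class.\<close>
  then have "a ** (a ** b) = a ** b ** a"
    by (metis commuting_adj_def matrix_mul_assoc)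
  with ab show "killing_adj (**) G invols a b"
    unfolding killing_adj_def commuting_adj_def invols_def by blast
qed

lemma W_neq_T: "W \<noteq> T a b"
proof
  assume "W = T a b"
  then have "W $ 1 $ 1 = T a b $ 1 $ 1" by simp
  then show False by (simp add: sz_T_def sz_W_def)
qed

lemma W_in_invols: "W \<in> invols"
  unfolding invols_def using W_in_G W_W W_neq_T[of 0 0] by (simp add: T_0_0)

text \<open>By transitivity of commuting, a path from \<open>T 0 1\<close> reaches only involutions
  commuting with it, and \<open>W\<close> is not one.\<close>

lemma not_killing_irreducible_invols: "\<not> killing_irreducible (**) G invols"
proof
  assume "killing_irreducible (**) G invols"
  then have "(killing_adj (**) G invols)\<^sup>*\<^sup>* (T 0 1) W"
    unfolding killing_irreducible_def graph_connected_def
    using W_in_invols by (simp add: T_0_in_invols_iff)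
  then have "T 0 1 ** W = W ** T 0 1"
  proof (induction rule: rtranclp_induct)
    case (step y z)
    then show ?case
      unfolding killing_adj_invols commuting_adj_def
      using invols_commute_trans[of "T 0 1" y z] by (simp add: T_0_in_invols_iff)
  qed simp
  then show False using commute_T_0_1_iff[OF W_in_invols] W_neq_T by auto
qed

text \<open>The product \<open>a ** b\<close> is trivial, an involution, or centralized by no
  involution; these cases give the diagonal, the rest of a block, and the zeros.\<close>

lemma killing_nondegenerate_invols: "killing_nondegenerate (**) G invols"
proof (rule killing_nondegenerate_block[where E = "\<lambda>a b. a ** b = b ** a"])
  let ?r = "card {c \<in> invols. T 0 1 ** c = c ** T 0 1}"
  show "\<forall>a\<in>invols. \<forall>b\<in>invols. killing_form (**) G invols a b =
      (if a = b then card invols else if a ** b = b ** a then ?r else 0)"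
  proof (intro ballI)
    fix a b assume ab: "a \<in> invols" "b \<in> invols"
    consider "a = b" | "a \<noteq> b" "a ** b = b ** a" | "a ** b \<noteq> b ** a" by blast
    then show "killing_form (**) G invols a b =
      (if a = b then card invols else if a ** b = b ** a then ?r else 0)"
    proof cases
      case 1
      then have "a ** b = I" using ab by (simp add: invols_def)
      then have "{x \<in> G. x ** (a ** b) = (a ** b) ** x} \<inter> invols = invols"
        by (auto simp: invols_def)
      with 1 show ?thesis by (simp add: killing_form_def)
    next
      case 2
      have "{x \<in> G. x ** (a ** b) = (a ** b) ** x} \<inter> invols = {c \<in> invols. (a ** b) ** c = c ** (a ** b)}"
        by (auto simp: invols_def)
      then show ?thesis
        using 2 card_commuting_invols[OF mult_commuting_invols[OF ab 2(2,1)]]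
        by (simp add: killing_form_def)
    next
      case 3
      then have "{x \<in> G. x ** (a ** b) = (a ** b) ** x} \<inter> invols = {}"
        using centralizer_of_product ab by blast
      then have "killing_form (**) G invols a b = 0"
        unfolding killing_form_def by (simp only: card.empty)
      with 3 show ?thesis by auto
    qed
  qed
  have "W \<notin> {c \<in> invols. T 0 1 ** c = c ** T 0 1}"
    using commute_T_0_1_iff[OF W_in_invols] W_neq_T by auto
  then show "?r < card invols"
    using W_in_invols by (intro psubset_card_mono) auto
  show "\<forall>a\<in>invols. \<forall>b\<in>invols. \<forall>c\<in>invols. a ** b = b ** a \<longrightarrow> b ** c = c ** b \<longrightarrow> a ** c = c ** a"
    using invols_commute_trans by blast
qed (auto simp: card_commuting_invols)

end

theorem theorem5p2:
  fixes n :: nat and t :: "'a::{field,finite} ^ 4 ^ 4"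
  assumes "CARD('a) = 2 ^ (2 * n + 1)"
    and "n \<ge> 1"
    and "t \<in> suzuki_group n" and "t \<noteq> mat 1" and "t ** t = mat 1"
  defines "G \<equiv> suzuki_group n"
    and "C \<equiv> conj_class (**) (suzuki_group n) t"
  shows "(\<forall>a b. killing_adj (**) G C a b \<longleftrightarrow> commuting_adj (**) C a b)
         \<and> \<not> killing_irreducible (**) G C
         \<and> killing_nondegenerate (**) G C"
proof -
  interpret suzuki n "TYPE('a)" by unfold_locales fact
  have "C = invols"
    unfolding C_def using assms(3-5) by (intro conj_class_eq_invols) (simp add: invols_def)
  then show ?thesis
    unfolding G_def
    by (simp add: killing_adj_invols not_killing_irreducible_invols killing_nondegenerate_invols)
qed

end
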